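(* Let $J\subsetneq\{1,\ldots,d\}$ be non-empty with $|J|=r<d$. Suppose that for each $j\notin J$, the statistic $u_j$ can be expressed as a polynomial of degree at most two in the retained statistics $(u_k)_{k\in J}$, $$u_j(x)=\sum_{k,l\in J}\alpha^{(j)}_{kl}\,u_k(x)\,u_l(x)+\sum_{k\in J}\beta^{(j)}_k\,u_k(x)+\gamma^{(j)}\qquad\mu\text{-a.e.},$$ for constants $\alpha^{(j)}_{kl},\beta^{(j)}_k,\gamma^{(j)}\in\mathbb{R}$. Then the partial embedding $\mathcal{F}_J:\mathcal{N}\to\mathrm{SPD}(r+1)$ is injective.
   Context: Let $(X,\mathcal{X},\mu)$ be a $\sigma$-finite measure space and let $\mathcal{M}_\mu$ be the set of measurable $p:X\to\mathbb{R}$ with $p>0$ $\mu$-a.e. and $\int_X p\,d\mu=1$. For $p\in\mathcal{M}_\mu$ write $\mathbb{E}_p[u]=\int_X u\,p\,d\mu$ (entrywise for matrices). Fix a reference density $p\in\mathcal{M}_\mu$. Let $B_p$ be the Banach space of ($\mu$-a.e. classes of) measurable $u:X\to\mathbb{R}$ such that $\mathbb{E}_p[\cosh(\alpha u)-1]<\infty$ for some $\alpha>0$ and $\mathbb{E}_p[u]=0$, with norm $\|u\|_p=\inf\{r>0:\mathbb{E}_p[\cosh(u/r)-1]\le 1\}$. For $u\in B_p$ let $K_p(u)=\log\mathbb{E}_p[e^u]\in[0,+\infty]$, $\mathrm{Dom}(K_p)=\{u\in B_p:K_p(u)<\infty\}$, with interior $\mathrm{Dom}(K_p)^\circ$ in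 $B_p$. Fix $d\ge 1$ and $u_1,\ldots,u_d\in B_p$ linearly independent in $L^2(p\cdot\mu)$ (standing assumption). Let $\Theta=\{\theta\in\mathbb{R}^d:\sum_j\theta_ju_j\in\mathrm{Dom}(K_p)^\circ\}$ (open), $\psi(\theta)=K_p(\sum_j\theta_ju_j)$, $p_\theta=e^{\sum_j\theta_ju_j-\psi(\theta)}p$, $\mathcal{N}=\{p_\theta:\theta\in\Theta\}$. For non-empty $J=\{j_1<\cdots<j_r\}\subseteq\{1,\ldots,d\}$ let $V_J(x)=(u_{j_1}(x),\ldots,u_{j_r}(x),1)^\top\in\mathbb{R}^{r+1}$. The partial embedding is $\mathcal{F}_J:\mathcal{N}\to\mathrm{SPD}(r+1)$, $\mathcal{F}_J(p_\theta)=S_J(\theta)=\mathbb{E}_{p_\theta}[V_J(x)V_J(x)^\top]$, where $\mathrm{SPD}(m)$ is the set of real symmetric positive definite $m\times m$ matrices. *)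

theory Defs
  imports "HOL-Analysis.Analysis" "Jordan_Normal_Form.Matrix"
begin

hide_const (open) Finite_Cartesian_Product.vec Finite_Cartesian_Product.vec.vec_nth
hide_type (open) Finite_Cartesian_Product.vec
no_notation Finite_Cartesian_Product.vec.vec_nth (infixl "$" 90)
no_notation Inner_Product.real_inner_class.inner (infixl "\<bullet>" 70)

definition positive_densities :: "'a measure \<Rightarrow> ('a \<Rightarrow> real) set" where
  "positive_densities M =
     {p \<in> borel_measurable M. (AE x in M. 0 < p x) \<and> has_bochner_integral M p 1}"

definition expect :: "'a measure \<Rightarrow> ('a \<Rightarrow> real) \<Rightarrow> ('a \<Rightarrow> real) \<Rightarrow> real" where
  "expect M p f = (\<integral>x. f x * p x \<partial>M)"

text \<open>The expectation of a nonnegative function as an extended real. It is needed because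
  the Bochner integral of a non-integrable function is \<open>0\<close>.\<close>

definition nn_expect :: "'a measure \<Rightarrow> ('a \<Rightarrow> real) \<Rightarrow> ('a \<Rightarrow> real) \<Rightarrow> ennreal" where
  "nn_expect M p f = (\<integral>\<^sup>+x. ennreal (f x * p x) \<partial>M)"

text \<open>The elements of the Banach space \<open>B\<^sub>p\<close> are \<open>\<mu>\<close>-a.e. classes; here they are represented by
  their members, so that \<open>orlicz_norm M p\<close> is a seminorm on \<open>orlicz_space M p\<close> whose kernel
  consists of the functions vanishing a.e. All notions below respect a.e. equality.\<close>

definition orlicz_space :: "'a measure \<Rightarrow> ('a \<Rightarrow> real) \<Rightarrow> ('a \<Rightarrow> real) set" where
  "orlicz_space M p =
     {u \<in> borel_measurable M.
        (\<exists>\<alpha>>0. nn_expect M p (\<lambda>x. cosh (\<alpha> * u x) - 1) < \<infinity>) \<and> expect M p u = 0}"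

definition orlicz_norm :: "'a measure \<Rightarrow> ('a \<Rightarrow> real) \<Rightarrow> ('a \<Rightarrow> real) \<Rightarrow> real" where
  "orlicz_norm M p u = Inf {r. 0 < r \<and> nn_expect M p (\<lambda>x. cosh (u x / r) - 1) \<le> 1}"

definition cumulant :: "'a measure \<Rightarrow> ('a \<Rightarrow> real) \<Rightarrow> ('a \<Rightarrow> real) \<Rightarrow> ereal" where
  "cumulant M p u =
     (let m = nn_expect M p (\<lambda>x. exp (u x)) in if m < \<infinity> then ereal (ln (enn2real m)) else \<infinity>)"

definition cumulant_dom :: "'a measure \<Rightarrow> ('a \<Rightarrow> real) \<Rightarrow> ('a \<Rightarrow> real) set" where
  "cumulant_dom M p = {u \<in> orlicz_space M p. cumulant M p u < \<infinity>}"

definition cumulant_dom_interior :: "'a measure \<Rightarrow> ('a \<Rightarrow> real) \<Rightarrow> ('a \<Rightarrow> real) set" where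
  "cumulant_dom_interior M p =
     {u \<in> orlicz_space M p. \<exists>\<epsilon>>0. \<forall>v \<in> orlicz_space M p.
        orlicz_norm M p (\<lambda>x. v x - u x) < \<epsilon> \<longrightarrow> v \<in> cumulant_dom M p}"

definition linear_indep_L2 ::
    "'a measure \<Rightarrow> ('a \<Rightarrow> real) \<Rightarrow> (nat \<Rightarrow> 'a \<Rightarrow> real) \<Rightarrow> nat \<Rightarrow> bool" where
  "linear_indep_L2 M p u d \<longleftrightarrow>
     (\<forall>c. (AE x in density M (\<lambda>x. ennreal (p x)). (\<Sum>j\<in>{1..d}. c j * u j x) = 0)
        \<longrightarrow> (\<forall>j\<in>{1..d}. c j = 0))"

definition lin_comb :: "(nat \<Rightarrow> 'a \<Rightarrow> real) \<Rightarrow> nat \<Rightarrow> (nat \<Rightarrow> real) \<Rightarrow> 'a \<Rightarrow> real" where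
  "lin_comb u d \<theta> = (\<lambda>x. \<Sum>j\<in>{1..d}. \<theta> j * u j x)"

definition natural_params ::
    "'a measure \<Rightarrow> ('a \<Rightarrow> real) \<Rightarrow> (nat \<Rightarrow> 'a \<Rightarrow> real) \<Rightarrow> nat \<Rightarrow> (nat \<Rightarrow> real) set" where
  "natural_params M p u d =
     {\<theta> \<in> {1..d} \<rightarrow>\<^sub>E UNIV. lin_comb u d \<theta> \<in> cumulant_dom_interior M p}"

definition log_partition ::
    "'a measure \<Rightarrow> ('a \<Rightarrow> real) \<Rightarrow> (nat \<Rightarrow> 'a \<Rightarrow> real) \<Rightarrow> nat \<Rightarrow> (nat \<Rightarrow> real) \<Rightarrow> real" where
  "log_partition M p u d \<theta> = real_of_ereal (cumulant M p (lin_comb u d \<theta>))"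

definition exp_density ::
    "'a measure \<Rightarrow> ('a \<Rightarrow> real) \<Rightarrow> (nat \<Rightarrow> 'a \<Rightarrow> real) \<Rightarrow> nat \<Rightarrow> (nat \<Rightarrow> real) \<Rightarrow> 'a \<Rightarrow> real" where
  "exp_density M p u d \<theta> = (\<lambda>x. exp (lin_comb u d \<theta> x - log_partition M p u d \<theta>) * p x)"

definition exp_family ::
    "'a measure \<Rightarrow> ('a \<Rightarrow> real) \<Rightarrow> (nat \<Rightarrow> 'a \<Rightarrow> real) \<Rightarrow> nat \<Rightarrow> ('a \<Rightarrow> real) set" where
  "exp_family M p u d = exp_density M p u d ` natural_params M p u d"

text \<open>For \<open>J = {j\<^sub>1 < \<dots> < j\<^sub>r}\<close> the entries are indexed from \<open>0\<close> to \<open>r\<close>, the last one being \<open>1\<close>.\<close>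

definition stat_vec :: "(nat \<Rightarrow> 'a \<Rightarrow> real) \<Rightarrow> nat set \<Rightarrow> 'a \<Rightarrow> real vec" where
  "stat_vec u J x =
     vec (card J + 1) (\<lambda>a. if a < card J then u (sorted_list_of_set J ! a) x else 1)"

definition SPD :: "nat \<Rightarrow> real mat set" where
  "SPD m = {A \<in> carrier_mat m m. A\<^sup>T = A \<and>
     (\<forall>v \<in> carrier_vec m. v \<noteq> 0\<^sub>v m \<longrightarrow> 0 < v \<bullet> (A *\<^sub>v v))}"

definition partial_embedding ::
    "'a measure \<Rightarrow> (nat \<Rightarrow> 'a \<Rightarrow> real) \<Rightarrow> nat set \<Rightarrow> ('a \<Rightarrow> real) \<Rightarrow> real mat" where
  "partial_embedding M u J q =
     mat (card J + 1) (card J + 1)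
       (\<lambda>(a, b). expect M q (\<lambda>x. stat_vec u J x $ a * stat_vec u J x $ b))"

end

theory Submission
  imports Defs
begin

text \<open>
  Write \<open>q\<^sub>\<theta>\<close> for the member \<open>exp_density M p u d \<theta>\<close> of the family. Since one coordinate of the
  statistic vector \<open>V\<close> is the constant \<open>1\<close>, the entries of the matrix \<open>E\<^bsub>q\<^esub> [V V\<^sup>T]\<close> are the
  total mass, the means of the retained statistics and the means of their pairwise products. A
  quadratic relation expresses the mean of a discarded statistic linearly through these
  entries, so the matrix determines the mean of every \<open>u j\<close> with \<open>1 \<le> j \<le> d\<close>
  (\<open>expect_quadratic_relation\<close>).

  It remains to see that the means determine the parameter. This is strict monotonicity of the
  gradient of the log-partition function, and it can be had without differentiating anything.
  Let \<open>q\<^sub>\<theta> = exp A * p\<close> and \<open>q\<^sub>\<eta> = exp B * p\<close>. Then \<open>A - B\<close> is a linear combination of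
  the statistics plus a constant, so it has the same mean under both densities, which says
  \<open>E\<^sub>p [(A - B) * (exp A - exp B)] = 0\<close>. The integrand is nonnegative and vanishes only where
  \<open>A = B\<close> (\<open>exponential_tilt_unique\<close>). Hence the affine combination \<open>A - B\<close> of the
  statistics is null; the statistics have \<open>p\<close>-mean zero and are linearly independent, so
  all its coefficients vanish (\<open>lin_comb_plus_const_null\<close>) and \<open>\<theta> = \<eta>\<close>.

  The same lemma gives positive definiteness: \<open>v\<^sup>T E\<^bsub>q\<^esub> [V V\<^sup>T] v\<close> is the second moment of
  \<open>v\<^sup>T V\<close>, again an affine combination of the statistics.

  All of this requires second moments of the statistics under \<open>q\<^sub>\<theta>\<close>, and this is where the
  interior of the domain of the cumulant functional enters. Small multiples of an Orlicz
  function have small Orlicz norm, so a point \<open>w\<close> of the interior may be moved a little in both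
  directions \<open>\<plusminus> v\<close> with \<open>exp (w \<plusminus> t v) p\<close> still integrable, and the sum of these
  two functions dominates a multiple of \<open>v\<^sup>2 exp w p\<close> (\<open>interior_second_moment\<close>).
\<close>

section \<open>Elementary inequalities\<close>

lemma abs_le_two_cosh: "\<bar>x\<bar> \<le> 2 * cosh (x::real)"
proof -
  have "\<bar>x\<bar> \<le> exp \<bar>x\<bar>" using exp_ge_add_one_self[of "\<bar>x\<bar>"] by linarith
  also have "\<dots> \<le> exp x + exp (- x)" by (cases "0 \<le> x") auto
  finally show ?thesis by (simp add: cosh_def)
qed

lemma square_le_two_exp: "x\<^sup>2 \<le> 2 * (exp x + exp (- x :: real))"
proof -
  have "\<bar>x\<bar>\<^sup>2 / 2 \<le> exp \<bar>x\<bar>" using exp_lower_Taylor_quadratic[of "\<bar>x\<bar>"] by simp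
  moreover have "exp \<bar>x\<bar> \<le> exp x + exp (- x)" by (cases "0 \<le> x") auto
  ultimately show ?thesis by simp
qed

lemma cosh_le_of_abs_le: "\<bar>x\<bar> \<le> \<bar>y\<bar> \<Longrightarrow> cosh x \<le> cosh (y::real)"
  using cosh_real_nonneg_le_iff[of "\<bar>x\<bar>" "\<bar>y\<bar>"] by simp

lemma cosh_minus_one_scale_le:
  assumes "0 \<le> l" "l \<le> 1"
  shows "cosh (l * x) - 1 \<le> l * (cosh x - 1 :: real)"
proof -
  have "exp (l * y) \<le> l * exp y + (1 - l)" for y :: real
    using convex_onD[OF exp_convex, where t = l and x = 0 and y = y] assms by (simp add: algebra_simps)
  from this[of x] this[of "- x"] show ?thesis
    by (simp add: cosh_def algebra_simps)
qed

lemma borel_measurable_cosh [measurable]: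
  fixes f :: "'a \<Rightarrow> real"
  shows "f \<in> borel_measurable M \<Longrightarrow> (\<lambda>x. cosh (f x)) \<in> borel_measurable M"
  by (simp add: cosh_def)

lemma integrable_mult_density:
  fixes f g q :: "'a \<Rightarrow> real"
  assumes [measurable]: "f \<in> borel_measurable M" "g \<in> borel_measurable M" "q \<in> borel_measurable M"
    and q: "AE x in M. 0 \<le> q x"
    and f: "integrable M (\<lambda>x. (f x)\<^sup>2 * q x)" and g: "integrable M (\<lambda>x. (g x)\<^sup>2 * q x)"
  shows "integrable M (\<lambda>x. f x * g x * q x)"
proof (rule Bochner_Integration.integrable_bound[OF Bochner_Integration.integrable_add[OF f g]])
  show "AE x in M. norm (f x * g x * q x) \<le> norm ((f x)\<^sup>2 * q x + (g x)\<^sup>2 * q x)"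
    using q
  proof eventually_elim
    case (elim x)
    have "\<bar>f x * g x\<bar> \<le> (f x)\<^sup>2 + (g x)\<^sup>2"
      using sum_squares_bound[of "\<bar>f x\<bar>" "\<bar>g x\<bar>"] abs_ge_zero[of "f x * g x"]
      unfolding abs_mult power2_abs by linarith
    then have "\<bar>f x * g x\<bar> * q x \<le> ((f x)\<^sup>2 + (g x)\<^sup>2) * q x"
      using elim by (rule mult_right_mono)
    with elim show ?case by (simp add: abs_mult algebra_simps)
  qed
qed measurable

section \<open>The Orlicz space and the interior of the cumulant domain\<close>

locale reference_density =
  fixes M :: "'a measure" and p :: "'a \<Rightarrow> real"
  assumes density: "p \<in> positive_densities M"
begin

lemma p_measurable [measurable]: "p \<in> borel_measurable M"
  and p_pos: "AE x in M. 0 < p x"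
  and p_integrable: "integrable M p"
  and p_integral: "(\<integral>x. p x \<partial>M) = 1"
  using density by (auto simp: positive_densities_def has_bochner_integral_iff)

lemma nn_expect_finite_iff:
  assumes [measurable]: "f \<in> borel_measurable M" and "\<And>x. 0 \<le> f x"
  shows "nn_expect M p f < \<infinity> \<longleftrightarrow> integrable M (\<lambda>x. f x * p x)"
proof -
  have "(\<integral>\<^sup>+x. ennreal (norm (f x * p x)) \<partial>M) = nn_expect M p f"
    unfolding nn_expect_def
    by (rule nn_integral_cong_AE) (use p_pos assms(2) in \<open>auto elim!: eventually_mono\<close>)
  then show ?thesis by (simp add: integrable_iff_bounded)
qed

lemma integrable_dominated:
  assumes "integrable M (\<lambda>x. g x * p x)" and [measurable]: "f \<in> borel_measurable M"
    and "\<And>x. \<bar>f x\<bar> \<le> g x"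
  shows "integrable M (\<lambda>x. f x * p x)"
proof (rule Bochner_Integration.integrable_bound[OF assms(1)])
  show "AE x in M. norm (f x * p x) \<le> norm (g x * p x)"
    using p_pos
  proof eventually_elim
    case (elim x)
    with assms(3)[of x] show ?case by (simp add: abs_mult mult_right_mono)
  qed
qed measurable

text \<open>Finiteness of an extended expectation of a nonnegative function is replaced by Bochner
  integrability, which composes better with domination. Since \<open>p\<close> has finite mass, the \<open>- 1\<close>
  in the Orlicz function may be dropped.\<close>

lemma orlicz_space_iff:
  "v \<in> orlicz_space M p \<longleftrightarrow> v \<in> borel_measurable M \<and> expect M p v = 0 \<and>
     (\<exists>\<alpha>>0. integrable M (\<lambda>x. cosh (\<alpha> * v x) * p x))"
proof -
  have "nn_expect M p (\<lambda>x. cosh (\<alpha> * v x) - 1) < \<infinity> \<longleftrightarrow> integrable M (\<lambda>x. cosh (\<alpha> * v x) * p x)"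
    if [measurable]: "v \<in> borel_measurable M" for \<alpha>
  proof -
    have "nn_expect M p (\<lambda>x. cosh (\<alpha> * v x) - 1) < \<infinity> \<longleftrightarrow>
        integrable M (\<lambda>x. (cosh (\<alpha> * v x) - 1) * p x)"
      by (rule nn_expect_finite_iff) (measurable, simp add: cosh_real_ge_1)
    also have "\<dots> \<longleftrightarrow> integrable M (\<lambda>x. cosh (\<alpha> * v x) * p x - p x)"
      by (simp add: left_diff_distrib)
    also have "\<dots> \<longleftrightarrow> integrable M (\<lambda>x. cosh (\<alpha> * v x) * p x)"
    proof
      assume "integrable M (\<lambda>x. cosh (\<alpha> * v x) * p x - p x)"
      from Bochner_Integration.integrable_add[OF this p_integrable]
      show "integrable M (\<lambda>x. cosh (\<alpha> * v x) * p x)" by simp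
    qed (intro Bochner_Integration.integrable_diff p_integrable)
    finally show ?thesis .
  qed
  then show ?thesis by (auto simp: orlicz_space_def)
qed

lemma cumulant_dom_iff:
  "v \<in> cumulant_dom M p \<longleftrightarrow> v \<in> orlicz_space M p \<and> integrable M (\<lambda>x. exp (v x) * p x)"
proof -
  have "nn_expect M p (\<lambda>x. exp (v x)) < \<infinity> \<longleftrightarrow> integrable M (\<lambda>x. exp (v x) * p x)"
    if "v \<in> orlicz_space M p"
    using that by (intro nn_expect_finite_iff) (auto simp: orlicz_space_def)
  then show ?thesis
    by (auto simp: cumulant_dom_def cumulant_def Let_def split: if_splits)
qed

lemma orlicz_measurable: "v \<in> orlicz_space M p \<Longrightarrow> v \<in> borel_measurable M"
  by (simp add: orlicz_space_iff)

lemma orlicz_integrable: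
  assumes "v \<in> orlicz_space M p"
  shows "integrable M (\<lambda>x. v x * p x)"
proof -
  obtain \<alpha> where "0 < \<alpha>" and int: "integrable M (\<lambda>x. cosh (\<alpha> * v x) * p x)"
    and [measurable]: "v \<in> borel_measurable M"
    using assms by (auto simp: orlicz_space_iff)
  show ?thesis
  proof (rule integrable_dominated)
    show "integrable M (\<lambda>x. (2 / \<alpha> * cosh (\<alpha> * v x)) * p x)"
      using integrable_mult_right[OF int, of "2 / \<alpha>"] by (simp add: mult.assoc)
    show "\<bar>v x\<bar> \<le> 2 / \<alpha> * cosh (\<alpha> * v x)" for x
      using abs_le_two_cosh[of "\<alpha> * v x"] \<open>0 < \<alpha>\<close> by (simp add: abs_mult field_simps)
  qed measurable
qed

lemma orlicz_integral: "v \<in> orlicz_space M p \<Longrightarrow> (\<integral>x. v x * p x \<partial>M) = 0"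
  by (simp add: orlicz_space_iff expect_def)

lemma orlicz_zero: "(\<lambda>x. 0) \<in> orlicz_space M p"
  by (auto simp: orlicz_space_iff expect_def p_integrable intro!: exI[of _ 1])

lemma orlicz_scale:
  assumes "v \<in> orlicz_space M p"
  shows "(\<lambda>x. t * v x) \<in> orlicz_space M p"
proof -
  obtain \<alpha> where "0 < \<alpha>" and int: "integrable M (\<lambda>x. cosh (\<alpha> * v x) * p x)"
    and [measurable]: "v \<in> borel_measurable M"
    using assms by (auto simp: orlicz_space_iff)
  \<comment> \<open>The \<open>1\<close> in the denominator covers \<open>t = 0\<close>.\<close>
  have "integrable M (\<lambda>x. cosh (\<alpha> / (1 + \<bar>t\<bar>) * (t * v x)) * p x)"
  proof (rule integrable_dominated[OF int])
    fix x
    have "\<bar>t\<bar> / (1 + \<bar>t\<bar>) * \<bar>\<alpha> * v x\<bar> \<le> 1 * \<bar>\<alpha> * v x\<bar>"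
      by (rule mult_right_mono) auto
    then have "cosh (\<alpha> / (1 + \<bar>t\<bar>) * (t * v x)) \<le> cosh (\<alpha> * v x)"
      by (intro cosh_le_of_abs_le) (simp add: abs_mult mult_ac)
    then show "\<bar>cosh (\<alpha> / (1 + \<bar>t\<bar>) * (t * v x))\<bar> \<le> cosh (\<alpha> * v x)" by simp
  qed measurable
  moreover have "0 < \<alpha> / (1 + \<bar>t\<bar>)" using \<open>0 < \<alpha>\<close> by simp
  moreover have "expect M p (\<lambda>x. t * v x) = 0"
    using orlicz_integral[OF assms] by (simp add: expect_def mult.assoc)
  ultimately show ?thesis by (subst orlicz_space_iff) auto
qed

text \<open>If \<open>\<alpha>\<close> works for \<open>v\<close> and \<open>\<beta>\<close> for \<open>w\<close>, then half of the smaller one works for the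
  sum: the mean of two numbers is no larger in absolute value than one of them.\<close>

lemma orlicz_add:
  assumes v: "v \<in> orlicz_space M p" and w: "w \<in> orlicz_space M p"
  shows "(\<lambda>x. v x + w x) \<in> orlicz_space M p"
proof -
  obtain \<alpha> where "0 < \<alpha>" and inta: "integrable M (\<lambda>x. cosh (\<alpha> * v x) * p x)"
    and [measurable]: "v \<in> borel_measurable M"
    using v by (auto simp: orlicz_space_iff)
  obtain \<beta> where "0 < \<beta>" and intb: "integrable M (\<lambda>x. cosh (\<beta> * w x) * p x)"
    and [measurable]: "w \<in> borel_measurable M"
    using w by (auto simp: orlicz_space_iff)
  define \<delta> where "\<delta> = min \<alpha> \<beta> / 2"
  have "0 < \<delta>" using \<open>0 < \<alpha>\<close> \<open>0 < \<beta>\<close> by (simp add: \<delta>_def)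
  have "integrable M (\<lambda>x. cosh (\<delta> * (v x + w x)) * p x)"
  proof (rule integrable_dominated)
    show "integrable M (\<lambda>x. (cosh (\<alpha> * v x) + cosh (\<beta> * w x)) * p x)"
      using Bochner_Integration.integrable_add[OF inta intb] by (simp add: distrib_right)
    fix x
    have "2 * \<delta> * \<bar>v x\<bar> \<le> \<alpha> * \<bar>v x\<bar>" "2 * \<delta> * \<bar>w x\<bar> \<le> \<beta> * \<bar>w x\<bar>"
      by (auto simp: \<delta>_def intro!: mult_right_mono)
    moreover have "\<bar>\<delta> * (v x + w x)\<bar> \<le> \<delta> * \<bar>v x\<bar> + \<delta> * \<bar>w x\<bar>"
      using \<open>0 < \<delta>\<close> by (simp add: abs_mult flip: distrib_left)
    ultimately have "\<bar>\<delta> * (v x + w x)\<bar> \<le> \<bar>\<alpha> * v x\<bar> \<or> \<bar>\<delta> * (v x + w x)\<bar> \<le> \<bar>\<beta> * w x\<bar>"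
      using \<open>0 < \<alpha>\<close> \<open>0 < \<beta>\<close> by (simp add: abs_mult) linarith
    then have "cosh (\<delta> * (v x + w x)) \<le> cosh (\<alpha> * v x) \<or> cosh (\<delta> * (v x + w x)) \<le> cosh (\<beta> * w x)"
      using cosh_le_of_abs_le by blast
    then show "\<bar>cosh (\<delta> * (v x + w x))\<bar> \<le> cosh (\<alpha> * v x) + cosh (\<beta> * w x)"
      using cosh_real_pos[of "\<alpha> * v x"] cosh_real_pos[of "\<beta> * w x"]
        cosh_real_pos[of "\<delta> * (v x + w x)"] by linarith
  qed measurable
  moreover have "expect M p (\<lambda>x. v x + w x) = 0"
    using orlicz_integral[OF v] orlicz_integral[OF w] orlicz_integrable[OF v] orlicz_integrable[OF w]
    by (simp add: expect_def distrib_right)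
  ultimately show ?thesis using \<open>0 < \<delta>\<close> by (subst orlicz_space_iff) auto
qed

text \<open>The norm is an infimum of radii, so one radius below \<open>\<epsilon>\<close> suffices. As
  \<open>cosh - 1\<close> is convex and vanishes at \<open>0\<close>, shrinking the argument by \<open>l\<close> shrinks the
  expectation, here called \<open>C\<close>, at least by the factor \<open>l\<close>. So \<open>l = 1 / (1 + C)\<close> brings it
  below \<open>1\<close>, and \<open>t\<close> is chosen such that the radius \<open>\<epsilon> / 2\<close> realises exactly this
  shrinking.\<close>

lemma orlicz_norm_small_multiple:
  assumes v: "v \<in> orlicz_space M p" and "0 < \<epsilon>"
  obtains t where "0 < t" "orlicz_norm M p (\<lambda>x. t * v x) < \<epsilon>"
    "orlicz_norm M p (\<lambda>x. - t * v x) < \<epsilon>"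
proof -
  obtain \<alpha> where "0 < \<alpha>" and fin: "nn_expect M p (\<lambda>x. cosh (\<alpha> * v x) - 1) < \<infinity>"
    and [measurable]: "v \<in> borel_measurable M"
    using v by (auto simp: orlicz_space_def)
  define C where "C = enn2real (nn_expect M p (\<lambda>x. cosh (\<alpha> * v x) - 1))"
  have C: "nn_expect M p (\<lambda>x. cosh (\<alpha> * v x) - 1) = ennreal C" "0 \<le> C"
    using fin by (simp_all add: C_def)
  define l where "l = 1 / (1 + C)"
  have l: "0 < l" "l \<le> 1" "l * C \<le> 1" using \<open>0 \<le> C\<close> by (simp_all add: l_def)
  define t where "t = l * \<alpha> * (\<epsilon> / 2)"
  have "0 < t" using l \<open>0 < \<alpha>\<close> \<open>0 < \<epsilon>\<close> by (simp add: t_def)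
  have "nn_expect M p (\<lambda>x. cosh (l * (\<alpha> * v x)) - 1)
      \<le> (\<integral>\<^sup>+x. ennreal l * ennreal ((cosh (\<alpha> * v x) - 1) * p x) \<partial>M)"
    unfolding nn_expect_def
  proof (rule nn_integral_mono_AE, use p_pos in eventually_elim)
    case (elim x)
    have "(cosh (l * (\<alpha> * v x)) - 1) * p x \<le> l * (cosh (\<alpha> * v x) - 1) * p x"
      using elim l by (intro mult_right_mono cosh_minus_one_scale_le) auto
    with l show ?case by (simp add: ennreal_mult'[symmetric] mult.assoc ennreal_leI)
  qed
  also have "\<dots> = ennreal l * ennreal C"
    unfolding C(1)[symmetric] nn_expect_def
    by (rule nn_integral_cmult) measurable
  also have "\<dots> \<le> 1"
    using l C(2) by (simp add: ennreal_mult'[symmetric])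
  finally have le: "nn_expect M p (\<lambda>x. cosh (l * (\<alpha> * v x)) - 1) \<le> 1" .
  have *: "orlicz_norm M p (\<lambda>x. s * v x) < \<epsilon>" if "\<bar>s\<bar> = t" for s
  proof -
    have "cosh (s * v x / (\<epsilon> / 2)) = cosh (l * (\<alpha> * v x))" for x
      using l \<open>0 < \<alpha>\<close> \<open>0 < \<epsilon>\<close> by (simp add: abs_mult that) (simp add: t_def)
    then have "\<epsilon> / 2 \<in> {r. 0 < r \<and> nn_expect M p (\<lambda>x. cosh (s * v x / r) - 1) \<le> 1}"
      using le \<open>0 < \<epsilon>\<close> by (simp only: mem_Collect_eq half_gt_zero_iff simp_thms)
    then have "orlicz_norm M p (\<lambda>x. s * v x) \<le> \<epsilon> / 2"
      unfolding orlicz_norm_def by (rule cInf_lower) (auto intro!: bdd_belowI[of _ 0])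
    with \<open>0 < \<epsilon>\<close> show ?thesis by simp
  qed
  show thesis using that[OF \<open>0 < t\<close> *[of t] *[of "- t"]] \<open>0 < t\<close> by simp
qed

text \<open>The points \<open>w - t * v\<close> and \<open>w + t * v\<close> lie in the neighbourhood of \<open>w\<close> that the
  interior provides, once \<open>t\<close> is so small that both multiples of \<open>v\<close> have norm below its radius.\<close>

lemma interior_exponential_moments:
  assumes w: "w \<in> cumulant_dom_interior M p" and v: "v \<in> orlicz_space M p"
  obtains t where "0 < t"
    "integrable M (\<lambda>x. (exp (w x + t * v x) + exp (w x - t * v x)) * p x)"
proof -
  have wB: "w \<in> orlicz_space M p" using w by (simp add: cumulant_dom_interior_def)
  obtain \<epsilon> where "0 < \<epsilon>" and \<epsilon>: "\<And>z. z \<in> orlicz_space M p \<Longrightarrow>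
      orlicz_norm M p (\<lambda>x. z x - w x) < \<epsilon> \<Longrightarrow> z \<in> cumulant_dom M p"
    using w by (auto simp: cumulant_dom_interior_def)
  obtain t where t: "0 < t" "orlicz_norm M p (\<lambda>x. t * v x) < \<epsilon>"
    "orlicz_norm M p (\<lambda>x. - t * v x) < \<epsilon>"
    using orlicz_norm_small_multiple[OF v \<open>0 < \<epsilon>\<close>] .
  have "integrable M (\<lambda>x. exp (w x + s * v x) * p x)" if "s = t \<or> s = - t" for s
    using \<epsilon>[OF orlicz_add[OF wB orlicz_scale[OF v, of s]]] that t by (auto simp: cumulant_dom_iff)
  from Bochner_Integration.integrable_add[OF this[of t] this[of "- t"]] show thesis
    by (intro that[OF t(1)]) (simp add: distrib_right)
qed

text \<open>The interior lies in the domain; this is the case of the zero direction.\<close>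

lemma interior_integrable:
  assumes "w \<in> cumulant_dom_interior M p"
  shows "integrable M (\<lambda>x. exp (w x) * p x)"
proof -
  obtain t :: real where "integrable M (\<lambda>x. (exp (w x + t * 0) + exp (w x - t * 0)) * p x)"
    using interior_exponential_moments[OF assms orlicz_zero] .
  then have "integrable M (\<lambda>x. 2 * (exp (w x) * p x))" by (simp add: mult.assoc)
  from integrable_mult_right[OF this, of "1 / 2"] show ?thesis by simp
qed

text \<open>The inequality \<open>x\<^sup>2 \<le> 2 * (exp x + exp (- x))\<close> at \<open>x = t * v\<close> trades the square for the two
  exponential moments that the interior provides.\<close>

lemma interior_second_moment:
  assumes w: "w \<in> cumulant_dom_interior M p" and v: "v \<in> orlicz_space M p"
  shows "integrable M (\<lambda>x. (v x)\<^sup>2 * (exp (w x) * p x))"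
proof -
  have [measurable]: "w \<in> borel_measurable M" "v \<in> borel_measurable M"
    using w v by (auto simp: cumulant_dom_interior_def orlicz_measurable)
  obtain t where "0 < t"
    and int: "integrable M (\<lambda>x. (exp (w x + t * v x) + exp (w x - t * v x)) * p x)"
    using interior_exponential_moments[OF w v] .
  have "integrable M (\<lambda>x. ((v x)\<^sup>2 * exp (w x)) * p x)"
  proof (rule integrable_dominated)
    show "integrable M (\<lambda>x. (2 / t\<^sup>2 * (exp (w x + t * v x) + exp (w x - t * v x))) * p x)"
      using integrable_mult_right[OF int, of "2 / t\<^sup>2"] by (simp only: mult.assoc)
    fix x
    have "(v x)\<^sup>2 \<le> 2 / t\<^sup>2 * (exp (t * v x) + exp (- (t * v x)))"
      using square_le_two_exp[of "t * v x"] \<open>0 < t\<close> by (simp add: power_mult_distrib field_simps)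
    from mult_right_mono[OF this, of "exp (w x)"]
    show "\<bar>(v x)\<^sup>2 * exp (w x)\<bar> \<le> 2 / t\<^sup>2 * (exp (w x + t * v x) + exp (w x - t * v x))"
      by (simp add: exp_add exp_diff exp_minus field_simps)
  qed measurable
  then show ?thesis by (simp add: mult.assoc)
qed

text \<open>Both factors of \<open>(A - B) * (exp A - exp B)\<close> have the same sign, so this product can only
  integrate to zero against the positive density \<open>p\<close> if it vanishes almost everywhere.\<close>

lemma exponential_tilt_unique:
  fixes A B :: "'a \<Rightarrow> real"
  assumes [measurable]: "A \<in> borel_measurable M" "B \<in> borel_measurable M"
    and intA: "integrable M (\<lambda>x. (A x - B x) * (exp (A x) * p x))"
    and intB: "integrable M (\<lambda>x. (A x - B x) * (exp (B x) * p x))"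
    and eq: "(\<integral>x. (A x - B x) * (exp (A x) * p x) \<partial>M) = (\<integral>x. (A x - B x) * (exp (B x) * p x) \<partial>M)"
  shows "AE x in M. A x = B x"
proof -
  define D where "D x = (A x - B x) * (exp (A x) * p x) - (A x - B x) * (exp (B x) * p x)" for x
  have D: "D x = (A x - B x) * (exp (A x) - exp (B x)) * p x" for x
    by (simp add: D_def algebra_simps)
  have intD: "integrable M D"
    unfolding D_def by (rule Bochner_Integration.integrable_diff[OF intA intB])
  have "integral\<^sup>L M D = 0"
    unfolding D_def using eq by (simp add: Bochner_Integration.integral_diff[OF intA intB])
  moreover have "AE x in M. 0 \<le> D x"
    using p_pos
  proof eventually_elim
    case (elim x)
    have "0 \<le> (A x - B x) * (exp (A x) - exp (B x))"
      by (cases "A x \<le> B x") (auto intro: mult_nonpos_nonpos)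
    with elim show ?case by (simp add: D)
  qed
  ultimately have "AE x in M. D x = 0"
    using integral_nonneg_eq_0_iff_AE[OF intD] by simp
  then show ?thesis
    using p_pos by eventually_elim (auto simp: D)
qed

end

section \<open>Reading moments off the embedding\<close>

lemma stat_vec_last: "stat_vec u J x $ card J = 1"
  by (simp add: stat_vec_def)

lemma stat_vec_statistic:
  "a < card J \<Longrightarrow> stat_vec u J x $ a = u (sorted_list_of_set J ! a) x"
  by (simp add: stat_vec_def)

lemma bij_betw_nth_sorted_list:
  "finite J \<Longrightarrow> bij_betw (nth (sorted_list_of_set J)) {..<card J} J"
  by (rule bij_betw_nth) simp_all

text \<open>Row and column \<open>card J\<close> belong to the constant coordinate; pairing them with each
  other and with the remaining ones gives the mass and the first moments.\<close>

lemma partial_embedding_eq_imp_moments_eq: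
  assumes J: "finite J" and eq: "partial_embedding M u J q = partial_embedding M u J q'"
  shows "expect M q (\<lambda>x. 1) = expect M q' (\<lambda>x. 1)"
    and "\<And>k. k \<in> J \<Longrightarrow> expect M q (u k) = expect M q' (u k)"
    and "\<And>k l. k \<in> J \<Longrightarrow> l \<in> J \<Longrightarrow>
      expect M q (\<lambda>x. u k x * u l x) = expect M q' (\<lambda>x. u k x * u l x)"
proof -
  have ent: "expect M q (\<lambda>x. stat_vec u J x $ a * stat_vec u J x $ b) =
      expect M q' (\<lambda>x. stat_vec u J x $ a * stat_vec u J x $ b)"
    if "a \<le> card J" "b \<le> card J" for a b
    using arg_cong[OF eq, of "\<lambda>S. S $$ (a, b)"] that by (simp add: partial_embedding_def)
  have idx: "\<exists>a<card J. k = sorted_list_of_set J ! a" if "k \<in> J" for k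
    using bij_betw_nth_sorted_list[OF J] that by (auto simp: bij_betw_def)
  show "expect M q (\<lambda>x. 1) = expect M q' (\<lambda>x. 1)"
    using ent[of "card J" "card J"] by (simp add: stat_vec_last)
  show "expect M q (u k) = expect M q' (u k)" if k: "k \<in> J" for k
  proof -
    from idx[OF k] obtain a where "a < card J" "k = sorted_list_of_set J ! a" by blast
    then show ?thesis using ent[of a "card J"] by (simp add: stat_vec_last stat_vec_statistic)
  qed
  show "expect M q (\<lambda>x. u k x * u l x) = expect M q' (\<lambda>x. u k x * u l x)"
    if k: "k \<in> J" and l: "l \<in> J" for k l
  proof -
    from idx[OF k] obtain a where "a < card J" "k = sorted_list_of_set J ! a" by blast
    moreover from idx[OF l] obtain b where "b < card J" "l = sorted_list_of_set J ! b" by blast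
    ultimately show ?thesis using ent[of a b] by (simp add: stat_vec_statistic)
  qed
qed

section \<open>The exponential family and its identification by means\<close>

locale exponential_family = reference_density +
  fixes u :: "nat \<Rightarrow> 'a \<Rightarrow> real" and d :: nat
  assumes statistics: "\<And>j. j \<in> {1..d} \<Longrightarrow> u j \<in> orlicz_space M p"
    and independent: "linear_indep_L2 M p u d"
begin

lemma u_measurable: "j \<in> {1..d} \<Longrightarrow> u j \<in> borel_measurable M"
  by (rule orlicz_measurable[OF statistics])

lemma lin_comb_measurable [measurable]: "lin_comb u d c \<in> borel_measurable M"
  unfolding lin_comb_def by (rule borel_measurable_sum) (use u_measurable in auto)

text \<open>Taking the \<open>p\<close>-mean kills the statistics and isolates the constant. What is left is a
  null linear combination, to which linear independence applies.\<close>

lemma lin_comb_plus_const_null: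
  assumes "AE x in M. lin_comb u d c x + c\<^sub>0 = 0"
  shows "c\<^sub>0 = 0" and "\<And>j. j \<in> {1..d} \<Longrightarrow> c j = 0"
proof -
  have int: "integrable M (\<lambda>x. c j * (u j x * p x))" if "j \<in> {1..d}" for j
    using orlicz_integrable[OF statistics[OF that]] by simp
  have "0 = (\<integral>x. (lin_comb u d c x + c\<^sub>0) * p x \<partial>M)"
    by (subst integral_cong_AE[where g = "\<lambda>x. 0"]) (use assms in \<open>auto elim!: eventually_mono\<close>)
  also have "\<dots> = (\<integral>x. (\<Sum>j\<in>{1..d}. c j * (u j x * p x)) + c\<^sub>0 * p x \<partial>M)"
    by (simp add: lin_comb_def distrib_right sum_distrib_right mult.assoc)
  also have "\<dots> = (\<integral>x. (\<Sum>j\<in>{1..d}. c j * (u j x * p x)) \<partial>M) + (\<integral>x. c\<^sub>0 * p x \<partial>M)"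
    using int p_integrable
    by (intro Bochner_Integration.integral_add Bochner_Integration.integrable_sum) auto
  also have "(\<integral>x. (\<Sum>j\<in>{1..d}. c j * (u j x * p x)) \<partial>M) = (\<Sum>j\<in>{1..d}. c j * (\<integral>x. u j x * p x \<partial>M))"
    using int by (subst Bochner_Integration.integral_sum) auto
  also have "\<dots> = 0"
    using orlicz_integral[OF statistics] by simp
  finally show 0: "c\<^sub>0 = 0" by (simp add: p_integral)
  have "AE x in density M (\<lambda>x. ennreal (p x)). (\<Sum>j\<in>{1..d}. c j * u j x) = 0"
    using assms 0 by (subst AE_density) (auto simp: lin_comb_def elim: eventually_mono)
  then show "c j = 0" if "j \<in> {1..d}" for j
    using independent that by (auto simp: linear_indep_L2_def)
qed

lemma exp_density_measurable [measurable]: "exp_density M p u d \<theta> \<in> borel_measurable M"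
  unfolding exp_density_def by measurable

lemma exp_density_pos: "AE x in M. 0 < exp_density M p u d \<theta> x"
  using p_pos by (auto simp: exp_density_def elim: eventually_mono)

lemma exp_density_eq:
  "exp_density M p u d \<theta> x = exp (- log_partition M p u d \<theta>) * (exp (lin_comb u d \<theta> x) * p x)"
  by (simp add: exp_density_def exp_diff exp_minus field_simps)

lemma integrable_exp_density:
  assumes "\<theta> \<in> natural_params M p u d"
  shows "integrable M (exp_density M p u d \<theta>)"
  unfolding exp_density_eq[abs_def]
  by (intro integrable_mult_right interior_integrable) (use assms in \<open>simp add: natural_params_def\<close>)

lemma integrable_square_exp_density:
  assumes "\<theta> \<in> natural_params M p u d" "j \<in> {1..d}"
  shows "integrable M (\<lambda>x. (u j x)\<^sup>2 * exp_density M p u d \<theta> x)"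
  using integrable_mult_right[OF interior_second_moment[OF _ statistics[OF assms(2)],
        of "lin_comb u d \<theta>"], of "exp (- log_partition M p u d \<theta>)"] assms(1)
  by (simp add: exp_density_eq natural_params_def mult_ac)

lemma integrable_product_exp_density:
  assumes "\<theta> \<in> natural_params M p u d" "j \<in> {1..d}" "k \<in> {1..d}"
  shows "integrable M (\<lambda>x. u j x * u k x * exp_density M p u d \<theta> x)"
  using assms exp_density_pos[of \<theta>]
  by (intro integrable_mult_density integrable_square_exp_density u_measurable)
     (auto elim: eventually_mono)

lemma integrable_statistic_exp_density:
  assumes "\<theta> \<in> natural_params M p u d" "j \<in> {1..d}"
  shows "integrable M (\<lambda>x. u j x * exp_density M p u d \<theta> x)"
proof -
  have "integrable M (\<lambda>x. u j x * 1 * exp_density M p u d \<theta> x)"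
    using exp_density_pos[of \<theta>] integrable_square_exp_density[OF assms]
      integrable_exp_density[OF assms(1)] u_measurable[OF assms(2)]
    by (intro integrable_mult_density) (auto elim: eventually_mono)
  then show ?thesis by simp
qed

text \<open>The mean of the affine function \<open>A - B\<close> is a linear expression in the mass and the means of
  the statistics; as these agree, \<open>exponential_tilt_unique\<close> applies. Equal mass is needed
  because \<open>A - B\<close> contains the difference of the two log-partition values.\<close>

lemma equal_means_imp_equal_params:
  assumes \<theta>: "\<theta> \<in> natural_params M p u d" and \<eta>: "\<eta> \<in> natural_params M p u d"
    and mass: "expect M (exp_density M p u d \<theta>) (\<lambda>x. 1) = expect M (exp_density M p u d \<eta>) (\<lambda>x. 1)"
    and means: "\<And>j. j \<in> {1..d} \<Longrightarrow>
      expect M (exp_density M p u d \<theta>) (u j) = expect M (exp_density M p u d \<eta>) (u j)"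
  shows "\<theta> = \<eta>"
proof -
  define c\<^sub>0 where "c\<^sub>0 = log_partition M p u d \<eta> - log_partition M p u d \<theta>"
  define A where "A x = lin_comb u d \<theta> x - log_partition M p u d \<theta>" for x
  define B where "B x = lin_comb u d \<eta> x - log_partition M p u d \<eta>" for x
  have AB: "A x - B x = lin_comb u d (\<lambda>j. \<theta> j - \<eta> j) x + c\<^sub>0" for x
    by (simp add: A_def B_def c\<^sub>0_def lin_comb_def sum_subtractf left_diff_distrib)
  have int: "has_bochner_integral M (\<lambda>x. (A x - B x) * exp_density M p u d \<zeta> x)
      ((\<Sum>j\<in>{1..d}. (\<theta> j - \<eta> j) * expect M (exp_density M p u d \<zeta>) (u j)) +
        c\<^sub>0 * expect M (exp_density M p u d \<zeta>) (\<lambda>x. 1))"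
    if \<zeta>: "\<zeta> \<in> natural_params M p u d" for \<zeta>
  proof -
    have "has_bochner_integral M (\<lambda>x. (\<Sum>j\<in>{1..d}. (\<theta> j - \<eta> j) * (u j x * exp_density M p u d \<zeta> x)) +
          c\<^sub>0 * (1 * exp_density M p u d \<zeta> x))
      ((\<Sum>j\<in>{1..d}. (\<theta> j - \<eta> j) * expect M (exp_density M p u d \<zeta>) (u j)) +
        c\<^sub>0 * expect M (exp_density M p u d \<zeta>) (\<lambda>x. 1))"
      unfolding expect_def
      by (intro has_bochner_integral_add has_bochner_integral_sum has_bochner_integral_mult_right
          has_bochner_integral_integrable)
         (use \<zeta> integrable_exp_density integrable_statistic_exp_density in auto)
    then show ?thesis
      by (simp add: AB lin_comb_def distrib_right sum_distrib_right mult.assoc)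
  qed
  have dens: "exp_density M p u d \<theta> = (\<lambda>x. exp (A x) * p x)"
    "exp_density M p u d \<eta> = (\<lambda>x. exp (B x) * p x)"
    by (simp_all add: exp_density_def A_def B_def)
  have "AE x in M. A x = B x"
  proof (rule exponential_tilt_unique)
    show "A \<in> borel_measurable M" "B \<in> borel_measurable M"
      unfolding A_def B_def by measurable
    show "(\<integral>x. (A x - B x) * (exp (A x) * p x) \<partial>M) = (\<integral>x. (A x - B x) * (exp (B x) * p x) \<partial>M)"
      using int[OF \<theta>] int[OF \<eta>] mass means
      by (simp add: dens has_bochner_integral_iff)
  qed (use int[OF \<theta>] int[OF \<eta>] in \<open>simp_all add: dens has_bochner_integral_iff\<close>)
  then have "AE x in M. lin_comb u d (\<lambda>j. \<theta> j - \<eta> j) x + c\<^sub>0 = 0"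
    by eventually_elim (simp flip: AB)
  from lin_comb_plus_const_null(2)[OF this] have "\<theta> j = \<eta> j" if "j \<in> {1..d}" for j
    using that by simp
  then show ?thesis
    using \<theta> \<eta> by (intro PiE_ext[of \<theta> "{1..d}" "\<lambda>_. UNIV" \<eta>]) (auto simp: natural_params_def)
qed

section \<open>The matrix of second moments\<close>

lemma expect_quadratic_relation:
  fixes \<alpha> :: "nat \<Rightarrow> nat \<Rightarrow> real"
  assumes \<theta>: "\<theta> \<in> natural_params M p u d" and J: "J \<subseteq> {1..d}" and j: "j \<in> {1..d}"
    and rel: "AE x in M. u j x =
      (\<Sum>k\<in>J. \<Sum>l\<in>J. \<alpha> k l * u k x * u l x) + (\<Sum>k\<in>J. \<beta> k * u k x) + \<gamma>"
  defines "q \<equiv> exp_density M p u d \<theta>"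
  shows "expect M q (u j) =
    (\<Sum>k\<in>J. \<Sum>l\<in>J. \<alpha> k l * expect M q (\<lambda>x. u k x * u l x)) + (\<Sum>k\<in>J. \<beta> k * expect M q (u k)) +
      \<gamma> * expect M q (\<lambda>x. 1)"
proof -
  have [measurable]: "u j \<in> borel_measurable M" "q \<in> borel_measurable M"
    using u_measurable[OF j] by (auto simp: q_def)
  have int: "has_bochner_integral M
     (\<lambda>x. (\<Sum>k\<in>J. \<Sum>l\<in>J. \<alpha> k l * (u k x * u l x * q x)) + (\<Sum>k\<in>J. \<beta> k * (u k x * q x)) + \<gamma> * (1 * q x))
     ((\<Sum>k\<in>J. \<Sum>l\<in>J. \<alpha> k l * expect M q (\<lambda>x. u k x * u l x)) + (\<Sum>k\<in>J. \<beta> k * expect M q (u k)) +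
      \<gamma> * expect M q (\<lambda>x. 1))" (is "has_bochner_integral M ?f ?I")
    unfolding expect_def q_def
    by (intro has_bochner_integral_add has_bochner_integral_sum has_bochner_integral_mult_right
          has_bochner_integral_integrable)
       (use J integrable_exp_density[OF \<theta>] integrable_statistic_exp_density[OF \<theta>]
          integrable_product_exp_density[OF \<theta>] in \<open>auto simp: subset_iff simp del: atLeastAtMost_iff\<close>)
  have "AE x in M. u j x * q x = ?f x"
    using rel by eventually_elim (simp add: distrib_right sum_distrib_right mult.assoc)
  then have "expect M q (u j) = integral\<^sup>L M ?f"
    unfolding expect_def using int
    by (intro integral_cong_AE) (auto dest: borel_measurable_has_bochner_integral)
  then show ?thesis using int by (simp add: has_bochner_integral_iff)
qed

text \<open>The coordinates of the statistic vector are numbered by position in the increasing list of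
  \<open>J\<close>; renumbering them by the statistics and padding with zeros outside \<open>J\<close> turns
  \<open>v\<^sup>T V\<close> into an affine combination of all \<open>d\<close> statistics.\<close>

lemma sum_stat_vec:
  assumes J: "J \<subseteq> {1..d}"
  obtains c where "\<And>x. (\<Sum>a<card J + 1. v a * stat_vec u J x $ a) = lin_comb u d c x + v (card J)"
    "\<And>a. a < card J \<Longrightarrow> \<exists>j\<in>{1..d}. c j = v a"
proof -
  have "finite J" using J finite_subset by blast
  define s where "s = nth (sorted_list_of_set J)"
  have bij: "bij_betw s {..<card J} J"
    unfolding s_def by (rule bij_betw_nth_sorted_list[OF \<open>finite J\<close>])
  define c where "c j = (if j \<in> J then v (the_inv_into {..<card J} s j) else 0)" for j
  have c: "c (s a) = v a" "s a \<in> J" if "a < card J" for a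
    using that bij by (auto simp: c_def bij_betw_def the_inv_into_f_f)
  show thesis
  proof
    fix x
    have "lin_comb u d c x = (\<Sum>j\<in>J. c j * u j x)"
      unfolding lin_comb_def using J by (intro sum.mono_neutral_right) (auto simp: c_def)
    also have "\<dots> = (\<Sum>a<card J. c (s a) * u (s a) x)"
      using sum.reindex_bij_betw[OF bij, of "\<lambda>j. c j * u j x"] by simp
    also have "\<dots> = (\<Sum>a<card J. v a * stat_vec u J x $ a)"
      by (rule sum.cong) (auto simp: c stat_vec_statistic s_def[symmetric])
    finally show "(\<Sum>a<card J + 1. v a * stat_vec u J x $ a) = lin_comb u d c x + v (card J)"
      by (simp add: stat_vec_last)
  next
    fix a assume "a < card J"
    with c[of a] J show "\<exists>j\<in>{1..d}. c j = v a" by blast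
  qed
qed

lemma integrable_stat_vec_product:
  assumes \<theta>: "\<theta> \<in> natural_params M p u d" and J: "J \<subseteq> {1..d}"
    and a: "a \<le> card J" and b: "b \<le> card J"
  shows "integrable M (\<lambda>x. stat_vec u J x $ a * stat_vec u J x $ b * exp_density M p u d \<theta> x)"
proof -
  have "finite J" using J finite_subset by blast
  have s: "sorted_list_of_set J ! i \<in> {1..d}" if "i < card J" for i
    using that J \<open>finite J\<close> nth_mem[of i "sorted_list_of_set J"]
    by (simp add: subset_iff del: atLeastAtMost_iff)
  have "(\<lambda>x. stat_vec u J x $ i) \<in> borel_measurable M \<and>
      integrable M (\<lambda>x. (stat_vec u J x $ i)\<^sup>2 * exp_density M p u d \<theta> x)" if "i \<le> card J" for i
  proof (cases "i < card J")
    case True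
    then show ?thesis
      using u_measurable[OF s[OF True]] integrable_square_exp_density[OF \<theta> s[OF True]]
      by (simp add: stat_vec_statistic)
  next
    case False
    with that have "i = card J" by simp
    then show ?thesis using integrable_exp_density[OF \<theta>] by (simp add: stat_vec_last)
  qed
  with a b show ?thesis
    using exp_density_pos[of \<theta>] by (intro integrable_mult_density) (auto elim: eventually_mono)
qed

text \<open>The quadratic form of the matrix at \<open>v\<close> is the second moment of \<open>L = v\<^sup>T V\<close>. If it
  vanishes, then \<open>L\<close> is null, and \<open>lin_comb_plus_const_null\<close> forces \<open>v = 0\<close>.\<close>

lemma partial_embedding_SPD:
  assumes \<theta>: "\<theta> \<in> natural_params M p u d" and J: "J \<subseteq> {1..d}"
  shows "partial_embedding M u J (exp_density M p u d \<theta>) \<in> SPD (card J + 1)"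
proof -
  define n where "n = card J + 1"
  define q where "q = exp_density M p u d \<theta>"
  define S where "S = partial_embedding M u J q"
  define V where "V a x = stat_vec u J x $ a" for a x
  have dim: "S \<in> carrier_mat n n" by (simp add: S_def n_def partial_embedding_def)
  have S: "S $$ (a, b) = expect M q (\<lambda>x. V a x * V b x)" if "a < n" "b < n" for a b
    using that by (simp add: S_def n_def V_def partial_embedding_def)
  have sym: "S\<^sup>T = S"
    using dim by (intro eq_matI) (auto simp: S mult.commute)
  have pos: "0 < v \<bullet> (S *\<^sub>v v)" if v: "v \<in> carrier_vec n" and nz: "v \<noteq> 0\<^sub>v n" for v
  proof -
    define L where "L x = (\<Sum>a<n. v $ a * V a x)" for x
    have "has_bochner_integral M (\<lambda>x. \<Sum>a<n. \<Sum>b<n. v $ a * v $ b * (V a x * V b x * q x))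
        (\<Sum>a<n. \<Sum>b<n. v $ a * v $ b * expect M q (\<lambda>x. V a x * V b x))"
      unfolding expect_def q_def V_def
      by (intro has_bochner_integral_sum has_bochner_integral_mult_right
          has_bochner_integral_integrable integrable_stat_vec_product[OF \<theta> J]) (auto simp: n_def)
    moreover have "(\<Sum>a<n. \<Sum>b<n. v $ a * v $ b * (V a x * V b x * q x)) = (L x)\<^sup>2 * q x" for x
      unfolding L_def power2_eq_square sum_product
      unfolding sum_distrib_right
      by (intro sum.cong refl) (simp add: mult_ac)
    moreover have "(\<Sum>a<n. \<Sum>b<n. v $ a * v $ b * expect M q (\<lambda>x. V a x * V b x)) = v \<bullet> (S *\<^sub>v v)"
      using v dim
      by (simp add: scalar_prod_def S sum_distrib_left atLeast0LessThan mult_ac)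
    ultimately have int: "has_bochner_integral M (\<lambda>x. (L x)\<^sup>2 * q x) (v \<bullet> (S *\<^sub>v v))" by simp
    have q: "AE x in M. 0 < q x" using exp_density_pos by (simp add: q_def)
    then have nn: "AE x in M. 0 \<le> (L x)\<^sup>2 * q x" by (auto elim: eventually_mono)
    have "0 \<le> v \<bullet> (S *\<^sub>v v)"
      using integral_nonneg_AE[OF nn] int by (simp add: has_bochner_integral_iff)
    moreover have "v \<bullet> (S *\<^sub>v v) \<noteq> 0"
    proof
      assume "v \<bullet> (S *\<^sub>v v) = 0"
      then have "AE x in M. (L x)\<^sup>2 * q x = 0"
        using int integral_nonneg_eq_0_iff_AE[OF _ nn] by (simp add: has_bochner_integral_iff)
      with q have L0: "AE x in M. L x = 0" by eventually_elim auto
      obtain c where c: "\<And>x. L x = lin_comb u d c x + v $ card J"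
        "\<And>a. a < card J \<Longrightarrow> \<exists>j\<in>{1..d}. c j = v $ a"
        using sum_stat_vec[OF J, of "\<lambda>a. v $ a"] unfolding L_def V_def n_def by metis
      from L0 have "AE x in M. lin_comb u d c x + v $ card J = 0" by (simp add: c(1))
      from lin_comb_plus_const_null[OF this] have "v $ a = 0" if "a < n" for a
        using c(2)[of a] that by (cases "a < card J") (auto simp: n_def less_Suc_eq)
      then have "v = 0\<^sub>v n" using v by (intro eq_vecI) auto
      with nz show False by simp
    qed
    ultimately show ?thesis by simp
  qed
  show ?thesis
    using dim sym pos unfolding SPD_def S_def q_def n_def by simp
qed

end

theorem theorem6p2:
  fixes M :: "'a measure" and p :: "'a \<Rightarrow> real"
    and u :: "nat \<Rightarrow> 'a \<Rightarrow> real" and d :: nat and J :: "nat set"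
  assumes "sigma_finite_measure M"
    and "p \<in> positive_densities M"
    and "1 \<le> d"
    and "\<forall>j\<in>{1..d}. u j \<in> orlicz_space M p"
    and "linear_indep_L2 M p u d"
    and "J \<noteq> {}" and "J \<subset> {1..d}"
    and "\<forall>j\<in>{1..d} - J. \<exists>(\<alpha> :: nat \<Rightarrow> nat \<Rightarrow> real) (\<beta> :: nat \<Rightarrow> real) (\<gamma> :: real).
           AE x in M. u j x =
             (\<Sum>k\<in>J. \<Sum>l\<in>J. \<alpha> k l * u k x * u l x) + (\<Sum>k\<in>J. \<beta> k * u k x) + \<gamma>"
  shows "partial_embedding M u J \<in> exp_family M p u d \<rightarrow> SPD (card J + 1)
       \<and> inj_on (partial_embedding M u J) (exp_family M p u d)"
proof -
  interpret exponential_family M p u d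
    using assms(2,4,5) by unfold_locales auto
  have J: "J \<subseteq> {1..d}" and "finite J"
    using assms(7) finite_subset[of J "{1..d}"] by auto
  have params: "\<theta> = \<eta>"
    if \<theta>: "\<theta> \<in> natural_params M p u d" and \<eta>: "\<eta> \<in> natural_params M p u d"
      and eq: "partial_embedding M u J (exp_density M p u d \<theta>) =
        partial_embedding M u J (exp_density M p u d \<eta>)" for \<theta> \<eta>
  proof (rule equal_means_imp_equal_params[OF \<theta> \<eta>])
    note moments = partial_embedding_eq_imp_moments_eq[OF \<open>finite J\<close> eq]
    show "expect M (exp_density M p u d \<theta>) (\<lambda>x. 1) = expect M (exp_density M p u d \<eta>) (\<lambda>x. 1)"
      by (rule moments(1))
    fix j assume j: "j \<in> {1..d}"
    show "expect M (exp_density M p u d \<theta>) (u j) = expect M (exp_density M p u d \<eta>) (u j)"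
    proof (cases "j \<in> J")
      case True
      then show ?thesis by (rule moments(2))
    next
      case False
      with j assms(8) obtain \<alpha> :: "nat \<Rightarrow> nat \<Rightarrow> real" and \<beta> :: "nat \<Rightarrow> real" and \<gamma> :: real
        where rel: "AE x in M. u j x =
          (\<Sum>k\<in>J. \<Sum>l\<in>J. \<alpha> k l * u k x * u l x) + (\<Sum>k\<in>J. \<beta> k * u k x) + \<gamma>"
        by (meson DiffI)
      show ?thesis
        unfolding expect_quadratic_relation[OF \<theta> J j rel] expect_quadratic_relation[OF \<eta> J j rel]
        by (simp add: moments)
    qed
  qed
  show ?thesis
    using partial_embedding_SPD[OF _ J] params
    by (auto simp: exp_family_def inj_on_def)
qed

end
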